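(* Let $-1<\nu<0$. Then $$\sum_{k \ge 1} \frac{\big(j_k^{\nu}\big)^2}{\Big[\big[(j_0^{\nu})'\big]^2 + \big(j_k^{\nu}\big)^2\Big]^2} = \frac{1}{4} + \frac{\nu^2}{4\big[(j_0^{\nu})'\big]^2}.$$
   Context: $\{j_n^{\nu}: n\ge1\}$ denotes the sequence of strictly positive zeros, in ascending order, of the Bessel function of the first kind $J_\nu$. For $-1<\nu<0$, $(j_0^{\nu})'$ denotes the unique strictly positive zero of $I_\nu'$, the derivative of the modified Bessel function of the first kind $I_\nu$. *)

theory Defs
  imports "HOL-Complex_Analysis.Complex_Analysis"
begin

(* Both functions are only meaningful for x > 0: real powr does not give a branch of
   z^nu for negative arguments.  rGamma is the entire function 1/Gamma. *)

definition bessel_J :: "real \<Rightarrow> real \<Rightarrow> real" where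
  "bessel_J \<nu> x =
     (x / 2) powr \<nu> * (\<Sum>k. (-1) ^ k * (x\<^sup>2 / 4) ^ k / fact k * rGamma (\<nu> + real k + 1))"

definition bessel_I :: "real \<Rightarrow> real \<Rightarrow> real" where
  "bessel_I \<nu> x =
     (x / 2) powr \<nu> * (\<Sum>k. (x\<^sup>2 / 4) ^ k / fact k * rGamma (\<nu> + real k + 1))"

(* For n >= 1 this is the n-th strictly positive zero of J_nu.  Index 0 only
   starts the recursion. *)

primrec bessel_J_zero :: "real \<Rightarrow> nat \<Rightarrow> real" where
  "bessel_J_zero \<nu> 0 = 0"
| "bessel_J_zero \<nu> (Suc n) = (LEAST x. x > bessel_J_zero \<nu> n \<and> bessel_J \<nu> x = 0)"

(* For -1 < nu < 0 there is exactly one such x. *)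

definition bessel_I_deriv_zero :: "real \<Rightarrow> real" where
  "bessel_I_deriv_zero \<nu> = (THE x. x > 0 \<and> deriv (bessel_I \<nu>) x = 0)"

end

theory Submission
  imports Defs "HOL-Real_Asymp.Real_Asymp"
begin

text \<open>
  Put \<open>w = x\<^sup>2 / 4\<close>. Up to a power of \<open>x\<close>, the functions \<open>I\<^sub>\<nu>(x)\<close> and \<open>J\<^sub>\<nu>(x)\<close> are
  \<open>F(w)\<close> and \<open>F(-w)\<close> for the entire function
  \<open>F(z) = (\<Sum>k. z ^ k / (k! \<Gamma>(\<nu> + k + 1)))\<close>. If \<open>j\<close> runs through the positive zeros of
  \<open>J\<^sub>\<nu>\<close> and \<open>b = j\<^sup>2 / 4\<close>, then the zeros of \<open>F\<close> are the numbers \<open>-b\<close>, and \<open>L = F' / F\<close>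
  has the partial fraction expansions \<open>L(w) = (\<Sum>b. 1 / (w + b))\<close> and
  \<open>-L'(w) = (\<Sum>b. 1 / (w + b)\<^sup>2)\<close>. Since
  \<open>j\<^sup>2 / (x\<^sup>2 + j\<^sup>2)\<^sup>2 = (b / (w + b)\<^sup>2) / 4\<close>, the sum in question is \<open>(L + w L') / 4\<close>.

  Both terms are known at the critical point \<open>x\<close> of \<open>I\<^sub>\<nu>\<close>. Differentiating
  \<open>x powr \<nu> F(x\<^sup>2 / 4)\<close> shows that \<open>I\<^sub>\<nu>'(x) = 0\<close> means \<open>\<nu> + 2 w L = 0\<close>, and the
  differential equation \<open>w F'' + (\<nu> + 1) F' = F\<close> gives the Riccati equation
  \<open>w (L' + L\<^sup>2) + (\<nu> + 1) L = 1\<close>. Hence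
  \<open>L + w L' = 1 - \<nu> L - w L\<^sup>2 = 1 + \<nu>\<^sup>2 / (4 w)\<close>, which is four times the right-hand side.

  The work lies in the expansions, which need the following facts.

  \<^item> The family is closed under differentiation (\<open>has_field_derivative_hyp01\<close>), and the
    differential equation is the contiguous relation \<open>hyp01_contiguous\<close>.

  \<^item> The zeros are simple: a double zero would annihilate all derivatives
    (\<open>hyp01_simple_zero\<close>). They are real, by a Sturm--Liouville argument
    (\<open>hyp01_zero_real\<close>), hence negative, as \<open>F > 0\<close> on \<open>[0, \<infinity>)\<close>.

  \<^item> For an entire function that grows more slowly than every \<open>exp (\<epsilon> |z|)\<close>, \<open>f' / f\<close> is the
    limit as \<open>R\<close> tends to \<open>\<infinity>\<close> of the sum of \<open>1 / (z - a)\<close> over the zeros with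
    \<open>|a| \<le> R\<close> (\<open>log_deriv_approx\<close>). Dividing out these zeros leaves a function
    without zeros in the disc of radius \<open>R\<close>; its logarithm is \<open>o(R)\<close> near the centre by the
    Borel--Caratheodory inequality, so by Cauchy's estimate its derivative is \<open>o(1)\<close>.

  \<^item> There are infinitely many zeros: a finite sum \<open>L\<close> would violate the Riccati equation
    as \<open>w\<close> tends to \<open>\<infinity>\<close> (\<open>infinite_neg_zeros\<close>). Hence the recursive minimum in the
    definition of the \<open>n\<close>-th zero is always attained, and the recursion exhausts the
    zeros (\<open>enumeration_by_Least\<close>).
\<close>

section \<open>Logarithmic derivatives of entire functions of exponential type zero\<close>

definition zeros_upto :: "(complex \<Rightarrow> complex) \<Rightarrow> real \<Rightarrow> complex set" where
  "zeros_upto f R = {z. f z = 0 \<and> norm z \<le> R}"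

lemma finite_zeros_upto:
  assumes f: "f holomorphic_on UNIV" and "f 0 \<noteq> 0"
  shows "finite (zeros_upto f R)"
proof (cases "f constant_on UNIV")
  case True
  hence "zeros_upto f R = {}" using \<open>f 0 \<noteq> 0\<close> by (auto simp: constant_on_def zeros_upto_def)
  thus ?thesis by simp
next
  case False
  have "finite {z \<in> cball 0 R. f z = 0}"
    by (rule holomorphic_compact_finite_zeros[OF f _ _ _ _ False]) auto
  also have "{z \<in> cball 0 R. f z = 0} = zeros_upto f R" by (auto simp: zeros_upto_def)
  finally show ?thesis .
qed

text \<open>
  The half-plane \<open>Re u < B\<close> is mapped into the unit disc by \<open>u \<mapsto> u / (2 B - u)\<close>, which
  fixes \<open>0\<close>, so the Schwarz lemma applies to the composition with \<open>h - h 0\<close>. On the disc of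
  half the radius the constant is simply \<open>2\<close>.
\<close>
lemma Borel_Caratheodory_half:
  fixes h :: "complex \<Rightarrow> complex"
  assumes h: "h holomorphic_on ball 0 R" and lt: "\<And>z. z \<in> ball 0 R \<Longrightarrow> Re (h z) < A"
    and z: "norm z \<le> R / 2" and R: "R > 0"
  shows "norm (h z - h 0) \<le> 2 * (A - Re (h 0))"
proof -
  define B where "B = A - Re (h 0)"
  have B: "B > 0" using lt[of 0] R by (simp add: B_def)
  define u where "u \<zeta> = h (of_real R * \<zeta>) - h 0" for \<zeta>
  define \<phi> where "\<phi> \<zeta> = u \<zeta> / (of_real (2 * B) - u \<zeta>)" for \<zeta>
  have in_ball: "of_real R * \<zeta> \<in> ball 0 R" if "norm \<zeta> < 1" for \<zeta> :: complex
    using that R by (simp add: norm_mult)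
  have Re_u: "Re (u \<zeta>) < B" if "norm \<zeta> < 1" for \<zeta>
    using lt[OF in_ball[OF that]] by (simp add: u_def B_def)
  have nz: "of_real (2 * B) - u \<zeta> \<noteq> 0" if "norm \<zeta> < 1" for \<zeta>
  proof
    assume "of_real (2 * B) - u \<zeta> = 0"
    hence "Re (u \<zeta>) = 2 * B" by (simp add: complex_eq_iff)
    thus False using Re_u[OF that] B by simp
  qed
  have "(h \<circ> (\<lambda>\<zeta>. of_real R * \<zeta>)) holomorphic_on ball 0 1"
    by (rule holomorphic_on_compose_gen[OF _ h]) (use in_ball in \<open>auto intro!: holomorphic_intros\<close>)
  hence hol_u: "u holomorphic_on ball 0 1"
    unfolding u_def o_def by (rule holomorphic_on_diff) (rule holomorphic_on_const)
  have "norm (\<phi> (z / of_real R)) \<le> norm (z / of_real R)"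
  proof (rule Schwarz_Lemma(1))
    show "\<phi> holomorphic_on ball 0 1"
      unfolding \<phi>_def using nz by (intro holomorphic_intros hol_u) auto
    show "\<phi> 0 = 0" by (simp add: \<phi>_def u_def)
    show "norm (z / of_real R) < 1" using z R by (simp add: norm_divide)
    fix \<zeta> :: complex assume \<zeta>: "norm \<zeta> < 1"
    have "(norm (of_real (2 * B) - u \<zeta>))\<^sup>2 - (norm (u \<zeta>))\<^sup>2 = 4 * B * (B - Re (u \<zeta>))"
      unfolding cmod_power2 by (simp add: power2_eq_square algebra_simps)
    also have "\<dots> > 0" using B Re_u[OF \<zeta>] by simp
    finally have "norm (u \<zeta>) < norm (of_real (2 * B) - u \<zeta>)"
      by (simp add: power_less_imp_less_base)
    thus "norm (\<phi> \<zeta>) < 1" using nz[OF \<zeta>] by (simp add: \<phi>_def norm_divide)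
  qed
  also have "\<dots> \<le> 1 / 2" using z R by (simp add: norm_divide field_simps)
  finally have le: "norm (\<phi> (z / of_real R)) \<le> 1 / 2" .
  have lt1: "norm (z / of_real R) < 1" using z R by (simp add: norm_divide)
  have uz: "u (z / of_real R) = h z - h 0" using R by (simp add: u_def)
  have "2 * norm (h z - h 0) \<le> norm (of_real (2 * B) - (h z - h 0))"
    using le nz[OF lt1] by (simp add: \<phi>_def norm_divide uz field_simps)
  also have "\<dots> \<le> 2 * B + norm (h z - h 0)"
    using norm_triangle_ineq4[of "of_real (2 * B)" "h z - h 0"] B by simp
  finally show ?thesis by (simp add: B_def)
qed

text \<open>
  The factors are normalized to \<open>1\<close> at the origin, so that \<open>g 0 = f 0\<close>, and to modulus at least
  \<open>1\<close> wherever \<open>|z| \<ge> 2 |a|\<close>, so that division does not increase the maximum on a large circle.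
\<close>
lemma divide_out_zeros:
  assumes "finite A" "f holomorphic_on UNIV" "\<And>a. a \<in> A \<Longrightarrow> f a = 0" "0 \<notin> A"
  shows "\<exists>g. g holomorphic_on UNIV \<and> (\<forall>z. f z = g z * (\<Prod>a\<in>A. 1 - z / a))"
  using assms
proof (induction A rule: finite_induct)
  case empty
  thus ?case by auto
next
  case (insert b A)
  then obtain g where g: "g holomorphic_on UNIV" "\<And>z. f z = g z * (\<Prod>a\<in>A. 1 - z / a)"
    by auto
  have b: "b \<noteq> 0" using insert.prems by auto
  have "(\<Prod>a\<in>A. 1 - b / a) \<noteq> 0"
    using insert.hyps insert.prems by (subst prod_zero_iff) auto
  moreover have "f b = 0" using insert.prems by auto
  ultimately have gb: "g b = 0" using g(2)[of b] by simp
  define k where "k z = - b * (if z = b then deriv g b else (g z - g b) / (z - b))" for z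
  have "k holomorphic_on UNIV"
    unfolding k_def by (intro holomorphic_intros pole_lemma_open g) auto
  moreover have "f z = k z * (\<Prod>a\<in>insert b A. 1 - z / a)" for z
  proof -
    have "g z = k z * (1 - z / b)"
      using b gb by (auto simp: k_def divide_simps) (auto simp: algebra_simps)
    thus ?thesis using insert.hyps g(2)[of z] by (simp add: mult_ac)
  qed
  ultimately show ?case by blast
qed

text \<open>
  The error \<open>E\<close> is the derivative of a logarithm of \<open>g = f / (\<Prod>a. 1 - z / a)\<close>. The circle of
  radius \<open>2 R\<close> bounds \<open>g\<close> by the growth of \<open>f\<close>, which gives an upper bound for the real part of
  the logarithm on the disc of radius \<open>R\<close>; the Borel--Caratheodory inequality and
  Cauchy's estimate turn it into a bound for \<open>E\<close>. The error is exhibited as a holomorphic function so that its derivative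
  can be estimated too.
\<close>
lemma log_deriv_approx:
  fixes f :: "complex \<Rightarrow> complex"
  assumes f: "f holomorphic_on UNIV" and f0: "f 0 \<noteq> 0"
    and simple: "\<And>z. f z = 0 \<Longrightarrow> deriv f z \<noteq> 0"
    and type: "\<And>\<epsilon>. \<epsilon> > 0 \<Longrightarrow> \<exists>C>0. \<forall>z. norm (f z) \<le> C * exp (\<epsilon> * norm z)"
    and \<delta>: "\<delta> > 0"
  shows "\<exists>R0. \<forall>R\<ge>R0. \<exists>E. E holomorphic_on ball 0 r \<and> (\<forall>z\<in>ball 0 r. norm (E z) \<le> \<delta> \<and>
           (f z \<noteq> 0 \<longrightarrow> E z = deriv f z / f z - (\<Sum>a\<in>zeros_upto f R. 1 / (z - a))))"
proof -
  obtain C where C: "C > 0" "\<And>z. norm (f z) \<le> C * exp (\<delta> / 32 * norm z)"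
    using type[of "\<delta> / 32"] \<delta> by auto
  \<comment> \<open>With the threshold for \<open>R\<close> chosen below, \<open>4 r\<close> keeps discs of radius \<open>R / 4\<close> about points of
     \<open>ball 0 r\<close> inside radius \<open>R / 2\<close>, and \<open>16 K / \<delta>\<close> comes from the final estimate
     \<open>8 (K + \<delta> R / 16) / R = 8 K / R + \<delta> / 2 \<le> \<delta>\<close>.\<close>
  define K where "K = ln C - ln (norm (f 0)) + 1"
  show ?thesis
  proof (intro exI[of _ "max 1 (max (4 * r) (16 * K / \<delta>))"] allI impI)
    fix R assume "R \<ge> max 1 (max (4 * r) (16 * K / \<delta>))"
    hence R: "R > 0" "4 * r \<le> R" "16 * K \<le> R * \<delta>" using \<delta> by (auto simp: field_simps)
    let ?A = "zeros_upto f R"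
    define P where "P z = (\<Prod>a\<in>?A. 1 - z / a)" for z
    have fin: "finite ?A" by (rule finite_zeros_upto[OF f f0])
    have A0: "a \<noteq> 0" if "a \<in> ?A" for a using that f0 by (auto simp: zeros_upto_def)
    have "\<exists>g. g holomorphic_on UNIV \<and> (\<forall>z. f z = g z * (\<Prod>a\<in>?A. 1 - z / a))"
      using f0 by (intro divide_out_zeros[OF fin f]) (auto simp: zeros_upto_def)
    then obtain g where g: "g holomorphic_on UNIV" "\<And>z. f z = g z * P z"
      unfolding P_def by blast
    have P_hol: "P holomorphic_on UNIV"
      unfolding P_def using A0 by (intro holomorphic_intros) auto
    \<comment> \<open>Simplicity enters here: a zero of \<open>g\<close> at a zero of \<open>f\<close> would be a double zero of \<open>f\<close>.\<close>
    have g_nz: "g z \<noteq> 0" if "norm z < R" for z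
    proof
      assume gz: "g z = 0"
      hence fz: "f z = 0" using g(2) by simp
      hence "z \<in> ?A" using that by (simp add: zeros_upto_def)
      hence Pz: "P z = 0" unfolding P_def using fin A0 by (auto simp: prod_zero_iff)
      have "((\<lambda>z. g z * P z) has_field_derivative deriv g z * P z + deriv P z * g z) (at z)"
        by (intro DERIV_mult holomorphic_derivI[OF g(1)] holomorphic_derivI[OF P_hol]) auto
      moreover have "(\<lambda>z. g z * P z) = f" using g(2) by auto
      ultimately have "deriv f z = 0" using gz Pz by (simp add: DERIV_imp_deriv)
      thus False using simple fz by blast
    qed
    have g0: "g 0 = f 0" using g(2)[of 0] by (simp add: P_def)
    have g_le: "norm (g z) \<le> C * exp (\<delta> / 32 * (2 * R))" if "norm z < R" for z
    proof (rule maximum_modulus_frontier[of g "ball 0 (2 * R)"])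
      fix z :: complex assume "z \<in> frontier (ball 0 (2 * R))"
      hence z: "norm z = 2 * R" using R by (simp add: frontier_ball)
      have "1 \<le> norm (1 - z / a)" if "a \<in> ?A" for a
      proof -
        have "norm a > 0" "norm a \<le> R" using A0[OF that] that by (auto simp: zeros_upto_def)
        hence "2 \<le> norm (z / a)" using z R by (simp add: norm_divide field_simps)
        thus ?thesis using norm_triangle_ineq2[of "z / a" 1] by (simp add: norm_minus_commute)
      qed
      hence "1 \<le> norm (P z)" unfolding P_def prod_norm[symmetric] by (intro prod_ge_1) auto
      hence "norm (g z) \<le> norm (f z)" unfolding g(2)[of z] norm_mult
        using mult_left_mono[of 1 "norm (P z)" "norm (g z)"] by simp
      thus "norm (g z) \<le> C * exp (\<delta> / 32 * (2 * R))" using C(2)[of z] z by simp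
    qed (use that R in \<open>auto intro!: holomorphic_on_imp_continuous_on holomorphic_on_subset[OF g(1)]\<close>)
    obtain h where h: "h holomorphic_on ball 0 R" "\<And>z. z \<in> ball 0 R \<Longrightarrow> exp (h z) = g z"
      by (rule holomorphic_logarithm_exists[of "ball 0 R" g 0])
         (use g_nz R in \<open>auto intro: holomorphic_on_subset[OF g(1)]\<close>)
    have Re_h: "Re (h z) = ln (norm (g z))" if "z \<in> ball 0 R" for z
      using h(2)[OF that, symmetric] by simp
    have Re_h_less: "Re (h z) < ln C + \<delta> / 16 * R + 1" if "z \<in> ball 0 R" for z
    proof -
      have "Re (h z) \<le> ln (C * exp (\<delta> / 32 * (2 * R)))"
        unfolding Re_h[OF that] using g_le[of z] g_nz[of z] that by (subst ln_le_cancel_iff) (use C in auto)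
      also have "\<dots> = ln C + \<delta> / 16 * R" using C(1) by (simp add: ln_mult)
      finally show ?thesis by simp
    qed
    have h_bound: "norm (h z - h 0) \<le> 2 * (K + \<delta> / 16 * R)" if "norm z \<le> R / 2" for z
      using Borel_Caratheodory_half[OF h(1) Re_h_less that R(1)] Re_h[of 0] R g0
      by (simp add: K_def algebra_simps)
    show "\<exists>E. E holomorphic_on ball 0 r \<and> (\<forall>z\<in>ball 0 r. norm (E z) \<le> \<delta> \<and>
           (f z \<noteq> 0 \<longrightarrow> E z = deriv f z / f z - (\<Sum>a\<in>?A. 1 / (z - a))))"
    proof (intro exI[of _ "deriv h"] conjI ballI impI)
      show "deriv h holomorphic_on ball 0 r"
        using R by (intro holomorphic_deriv holomorphic_on_subset[OF h(1)]) auto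
    next
      fix z :: complex assume "z \<in> ball 0 r"
      hence z: "norm z < R / 4" using R by simp
      have sub: "cball z (R / 4) \<subseteq> ball 0 R"
      proof
        fix w assume "w \<in> cball z (R / 4)"
        hence "norm (w - z) \<le> R / 4" by (simp add: dist_norm norm_minus_commute)
        hence "norm w \<le> R / 4 + norm z" using norm_triangle_sub[of w z] by simp
        thus "w \<in> ball 0 R" using z R by simp
      qed
      have hol: "(\<lambda>w. h w - h 0) holomorphic_on cball z (R / 4)"
        by (intro holomorphic_intros holomorphic_on_subset[OF h(1) sub])
      have "norm ((deriv ^^ 1) (\<lambda>w. h w - h 0) z) \<le> fact 1 * (2 * (K + \<delta> / 16 * R)) / (R / 4) ^ 1"
      proof (rule Cauchy_inequality)
        fix w assume "norm (z - w) = R / 4"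
        hence "norm w \<le> R / 2"
          using z norm_triangle_sub[of w z] by (simp add: norm_minus_commute)
        thus "norm (h w - h 0) \<le> 2 * (K + \<delta> / 16 * R)" by (rule h_bound)
      qed (use R hol in \<open>auto intro: holomorphic_on_imp_continuous_on holomorphic_on_subset\<close>)
      moreover have hd: "(h has_field_derivative deriv h z) (at z)"
        using h(1) z R by (intro holomorphic_derivI[OF h(1)]) auto
      hence "deriv (\<lambda>w. h w - h 0) z = deriv h z"
        by (intro DERIV_imp_deriv) (auto intro!: derivative_eq_intros)
      ultimately have "norm (deriv h z) \<le> 8 * (K + \<delta> / 16 * R) / R" using R by (simp add: field_simps)
      also have "\<dots> \<le> \<delta>" using R by (simp add: field_simps)
      finally show "norm (deriv h z) \<le> \<delta>" .
      assume fz: "f z \<noteq> 0"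
      hence za: "z \<noteq> a" if "a \<in> ?A" for a using that by (auto simp: zeros_upto_def)
      have zR: "z \<in> ball 0 R" using z R by simp
      have "(P has_field_derivative P z * (\<Sum>a\<in>?A. (- 1 / a) / (1 - z / a))) (at z)"
        unfolding P_def
        by (rule has_field_derivative_prod')
           (use A0 za in \<open>auto intro!: derivative_eq_intros\<close>)
      also have "(\<Sum>a\<in>?A. (- 1 / a) / (1 - z / a)) = (\<Sum>a\<in>?A. 1 / (z - a))"
      proof (rule sum.cong[OF refl])
        fix a assume a: "a \<in> ?A"
        show "(- 1 / a) / (1 - z / a) = 1 / (z - a)"
          using A0[OF a] za[OF a] by (simp add: divide_simps) 
      qed
      finally have dP: "(P has_field_derivative P z * (\<Sum>a\<in>?A. 1 / (z - a))) (at z)" .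
      have "((\<lambda>z. exp (h z) * P z) has_field_derivative
              f z * (deriv h z + (\<Sum>a\<in>?A. 1 / (z - a)))) (at z)"
        by (rule derivative_eq_intros hd dP refl)+
           (simp add: g(2)[of z] h(2)[OF zR] algebra_simps)
      hence "(f has_field_derivative f z * (deriv h z + (\<Sum>a\<in>?A. 1 / (z - a)))) (at z)"
        by (rule has_field_derivative_transform_within_open[where S = "ball 0 R"])
           (use zR h(2) g(2) in auto)
      hence "deriv f z = f z * (deriv h z + (\<Sum>a\<in>?A. 1 / (z - a)))" by (rule DERIV_imp_deriv)
      thus "deriv h z = deriv f z / f z - (\<Sum>a\<in>?A. 1 / (z - a))" using fz by (simp add: field_simps)
    qed
  qed
qed

text \<open>
  For the second limit, Cauchy's estimate on the
  unit disc about \<open>w\<close> bounds the derivative of the holomorphic error \<open>E\<close> of \<open>log_deriv_approx\<close>.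
\<close>
lemma
  fixes f :: "complex \<Rightarrow> complex"
  assumes f: "f holomorphic_on UNIV" and f0: "f 0 \<noteq> 0"
    and simple: "\<And>z. f z = 0 \<Longrightarrow> deriv f z \<noteq> 0"
    and type: "\<And>\<epsilon>. \<epsilon> > 0 \<Longrightarrow> \<exists>C>0. \<forall>z. norm (f z) \<le> C * exp (\<epsilon> * norm z)"
    and w: "f w \<noteq> 0"
  shows log_deriv_partial_fractions:
      "((\<lambda>R. \<Sum>a\<in>zeros_upto f R. 1 / (w - a)) \<longlongrightarrow> deriv f w / f w) at_top" (is ?T1)
    and deriv_log_deriv_partial_fractions:
      "((\<lambda>R. \<Sum>a\<in>zeros_upto f R. - 1 / (w - a)\<^sup>2) \<longlongrightarrow> deriv (\<lambda>z. deriv f z / f z) w) at_top" (is ?T2)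
proof -
  let ?L = "\<lambda>z. deriv f z / f z"
  have approx: "\<forall>\<^sub>F R in at_top. norm ((\<Sum>a\<in>zeros_upto f R. 1 / (w - a)) - ?L w) < e \<and>
      norm ((\<Sum>a\<in>zeros_upto f R. - 1 / (w - a)\<^sup>2) - deriv ?L w) < e" if e: "e > 0" for e
  proof -
    obtain R0 where R0: "\<And>R. R \<ge> R0 \<Longrightarrow> \<exists>E. E holomorphic_on ball 0 (norm w + 2) \<and>
        (\<forall>z\<in>ball 0 (norm w + 2). norm (E z) \<le> e / 2 \<and>
           (f z \<noteq> 0 \<longrightarrow> E z = ?L z - (\<Sum>a\<in>zeros_upto f R. 1 / (z - a))))"
      using log_deriv_approx[OF f f0 simple type, of "e / 2" "norm w + 2"] e by auto
    show ?thesis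
    proof (rule eventually_mono[OF eventually_ge_at_top[of R0]], intro conjI)
      fix R assume "R \<ge> R0"
      then obtain E where hol: "E holomorphic_on ball 0 (norm w + 2)"
        and le: "\<And>z. z \<in> ball 0 (norm w + 2) \<Longrightarrow> norm (E z) \<le> e / 2"
        and eq: "\<And>z. z \<in> ball 0 (norm w + 2) \<Longrightarrow> f z \<noteq> 0 \<Longrightarrow>
                   E z = ?L z - (\<Sum>a\<in>zeros_upto f R. 1 / (z - a))"
        using R0 by blast
      have wb: "w \<in> ball 0 (norm w + 2)" by simp
      show "norm ((\<Sum>a\<in>zeros_upto f R. 1 / (w - a)) - ?L w) < e"
        using le[OF wb] eq[OF wb w] e by (simp add: norm_minus_commute)
      have sub: "cball w 1 \<subseteq> ball 0 (norm w + 2)"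
      proof
        fix z assume "z \<in> cball w 1"
        hence "norm (z - w) \<le> 1" by (simp add: dist_norm norm_minus_commute)
        thus "z \<in> ball 0 (norm w + 2)" using norm_triangle_sub[of z w] by simp
      qed
      have "norm ((deriv ^^ 1) E w) \<le> fact 1 * (e / 2) / 1 ^ 1"
      proof (rule Cauchy_inequality)
        show "continuous_on (cball w 1) E"
          by (intro holomorphic_on_imp_continuous_on holomorphic_on_subset[OF hol] sub)
        show "E holomorphic_on ball w 1"
          by (rule holomorphic_on_subset[OF hol order.trans[OF ball_subset_cball sub]])
        show "norm (E z) \<le> e / 2" if "norm (w - z) = 1" for z
          using le[of z] subsetD[OF sub, of z] that by (auto simp: dist_norm)
      qed auto
      moreover have "deriv E w = deriv ?L w - (\<Sum>a\<in>zeros_upto f R. - 1 / (w - a)\<^sup>2)"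
      proof (rule DERIV_imp_deriv, rule has_field_derivative_transform_within_open)
        let ?U = "ball 0 (norm w + 2) \<inter> {z. f z \<noteq> 0}"
        have "open {z. f z \<noteq> 0}"
          using holomorphic_on_imp_continuous_on[OF f] by (intro open_Collect_neq) auto
        thus "open ?U" by auto
        show "w \<in> ?U" using w by simp
        show "?L z - (\<Sum>a\<in>zeros_upto f R. 1 / (z - a)) = E z" if "z \<in> ?U" for z
          using eq that by simp
        have "?L field_differentiable at w"
          by (intro field_differentiable_divide holomorphic_on_imp_differentiable_at[of _ UNIV]
                holomorphic_deriv f w) auto
        hence "(?L has_field_derivative deriv ?L w) (at w)"
          by (rule field_differentiable_derivI)
        moreover have "((\<lambda>z. \<Sum>a\<in>zeros_upto f R. 1 / (z - a)) has_field_derivative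
            (\<Sum>a\<in>zeros_upto f R. - 1 / (w - a)\<^sup>2)) (at w)"
        proof (rule DERIV_sum)
          fix a assume "a \<in> zeros_upto f R"
          hence "w \<noteq> a" using w by (auto simp: zeros_upto_def)
          thus "((\<lambda>z. 1 / (z - a)) has_field_derivative - 1 / (w - a)\<^sup>2) (at w)"
            by (auto intro!: derivative_eq_intros simp: power2_eq_square)
        qed
        ultimately show "((\<lambda>z. ?L z - (\<Sum>a\<in>zeros_upto f R. 1 / (z - a))) has_field_derivative
            deriv ?L w - (\<Sum>a\<in>zeros_upto f R. - 1 / (w - a)\<^sup>2)) (at w)"
          by (rule DERIV_diff)
      qed
      ultimately show "norm ((\<Sum>a\<in>zeros_upto f R. - 1 / (w - a)\<^sup>2) - deriv ?L w) < e"
        using e by (simp add: norm_minus_commute)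
    qed
  qed
  show ?T1
    unfolding tendsto_iff dist_norm by (intro allI impI, rule eventually_mono[OF approx]) auto
  show ?T2
    unfolding tendsto_iff dist_norm by (intro allI impI, rule eventually_mono[OF approx]) auto
qed

section \<open>The entire function underlying the Bessel functions\<close>

definition bessel_coeff :: "real \<Rightarrow> nat \<Rightarrow> real" where
  "bessel_coeff \<nu> k = rGamma (\<nu> + real k + 1) / fact k"

text \<open>
  This is \<open>0F1(; \<nu> + 1; z) / \<Gamma>(\<nu> + 1)\<close>, the regularized confluent hypergeometric limit function. The
  polymorphic type gives the real and the complex function at once.
\<close>
definition hyp01 :: "real \<Rightarrow> 'a \<Rightarrow> 'a::{real_normed_field,banach}" where
  "hyp01 \<nu> z = (\<Sum>k. of_real (bessel_coeff \<nu> k) * z ^ k)"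

lemma rGamma_pos:
  fixes x :: real
  assumes "x > 0"
  shows "rGamma x > 0"
  using Gamma_real_pos[OF assms] by (simp add: rGamma_inverse_Gamma)

text \<open>
  The ratio of consecutive values of \<open>1 / \<Gamma>(\<nu> + k + 1)\<close> tends to \<open>0\<close>, so they decay faster than any
  geometric sequence. Together with the factor \<open>1 / k!\<close> this makes \<open>hyp01\<close> of exponential type
  zero (\<open>norm_hyp01_le\<close>).
\<close>
lemma rGamma_geometric_bound:
  fixes \<nu> \<epsilon> :: real
  assumes nu: "\<nu> > -1" and eps: "\<epsilon> > 0"
  obtains C where "C > 0" "\<And>k::nat. rGamma (\<nu> + real k + 1) \<le> C * \<epsilon> ^ k"
proof -
  define d where "d k = rGamma (\<nu> + real k + 1) / \<epsilon> ^ k" for k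
  have pos: "d k > 0" for k
    unfolding d_def using nu eps by (intro divide_pos_pos rGamma_pos) auto
  have step: "d (Suc k) * ((\<nu> + real k + 1) * \<epsilon>) = d k" for k
  proof -
    have "rGamma (\<nu> + real k + 1) = (\<nu> + real k + 1) * rGamma (\<nu> + real (Suc k) + 1)"
      using rGamma_plus1[of "\<nu> + real k + 1"] by (simp add: add_ac)
    thus ?thesis using eps by (simp only: d_def power_Suc) (simp add: divide_simps)
  qed
  obtain N :: nat where N: "real N > 2 / \<epsilon> + 1" using reals_Archimedean2 by blast
  have "summable d"
  proof (rule summable_ratio_test[of "1/2" N])
    fix k assume "k \<ge> N"
    hence "(\<nu> + real k + 1) * \<epsilon> \<ge> (2 / \<epsilon>) * \<epsilon>"
      using N nu eps by (intro mult_right_mono) auto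
    hence "(\<nu> + real k + 1) * \<epsilon> \<ge> 2" using eps by simp
    hence "d (Suc k) * 2 \<le> d k"
      unfolding step[of k, symmetric] using pos[of "Suc k"] by (intro mult_left_mono) auto
    thus "norm (d (Suc k)) \<le> 1/2 * norm (d k)" using pos[of k] pos[of "Suc k"] by simp
  qed simp
  hence "d k \<le> suminf d" for k
    using sum_le_suminf[of d "{k}"] pos by (auto simp: less_imp_le)
  moreover have "suminf d > 0" using \<open>summable d\<close> pos by (intro suminf_pos) auto
  ultimately show ?thesis using eps by (intro that[of "suminf d"]) (auto simp: d_def field_simps)
qed

lemma bessel_coeff_pos: "\<nu> > -1 \<Longrightarrow> bessel_coeff \<nu> k > 0"
  unfolding bessel_coeff_def by (intro divide_pos_pos rGamma_pos) auto

lemma hyp01_summable_norm: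
  fixes z :: "'a::{real_normed_field,banach}"
  assumes "\<nu> > -1"
  shows "summable (\<lambda>k. norm (of_real (bessel_coeff \<nu> k) * z ^ k))"
proof -
  obtain C where C: "C > 0" "\<And>k::nat. rGamma (\<nu> + real k + 1) \<le> C * 1 ^ k"
    using rGamma_geometric_bound[OF assms, of 1] by auto
  show ?thesis
  proof (rule summable_comparison_test[OF _ summable_mult[OF summable_exp[of "norm z"], of C]])
    have "bessel_coeff \<nu> k \<le> C / fact k" for k
      using C(2)[of k] by (simp add: bessel_coeff_def divide_right_mono)
    hence "bessel_coeff \<nu> k * norm z ^ k \<le> C / fact k * norm z ^ k" for k
      by (intro mult_right_mono) auto
    thus "\<exists>N. \<forall>n\<ge>N. norm (norm (of_real (bessel_coeff \<nu> n) * z ^ n)) \<le> C * (inverse (fact n) * norm z ^ n)"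
      using bessel_coeff_pos[OF assms]
      by (auto simp: norm_mult norm_power field_simps less_imp_le abs_of_pos)
  qed
qed

lemmas hyp01_summable = summable_norm_cancel[OF hyp01_summable_norm]

lemma norm_hyp01_le:
  fixes \<nu> \<epsilon> :: real
  assumes nu: "\<nu> > -1" and eps: "\<epsilon> > 0"
  obtains C where "C > 0" "\<And>z::'a::{real_normed_field,banach}. norm (hyp01 \<nu> z) \<le> C * exp (\<epsilon> * norm z)"
proof -
  obtain C where C: "C > 0" "\<And>k::nat. rGamma (\<nu> + real k + 1) \<le> C * \<epsilon> ^ k"
    using rGamma_geometric_bound[OF assms] by auto
  have "norm (hyp01 \<nu> z) \<le> C * exp (\<epsilon> * norm z)" for z :: 'a
  proof -
    have "norm (hyp01 \<nu> z) \<le> (\<Sum>k. norm (of_real (bessel_coeff \<nu> k) * z ^ k))"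
      unfolding hyp01_def by (rule summable_norm[OF hyp01_summable_norm[OF nu]])
    also have "\<dots> \<le> (\<Sum>k. C * (inverse (fact k) * (\<epsilon> * norm z) ^ k))"
    proof (intro suminf_le hyp01_summable_norm[OF nu] summable_mult summable_exp)
      fix k
      have "bessel_coeff \<nu> k \<le> C * \<epsilon> ^ k / fact k"
        using C(2)[of k] by (simp add: bessel_coeff_def divide_right_mono)
      hence "bessel_coeff \<nu> k * norm z ^ k \<le> C * \<epsilon> ^ k / fact k * norm z ^ k"
        by (intro mult_right_mono) auto
      thus "norm (of_real (bessel_coeff \<nu> k) * z ^ k) \<le> C * (inverse (fact k) * (\<epsilon> * norm z) ^ k)"
        using bessel_coeff_pos[OF nu, of k]
        by (simp add: norm_mult norm_power field_simps power_mult_distrib)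
    qed
    also have "\<dots> = C * exp (\<epsilon> * norm z)"
      by (subst suminf_mult[OF summable_exp]) (simp add: exp_def divide_inverse mult.commute)
    finally show ?thesis .
  qed
  thus ?thesis using C(1) that by blast
qed

lemma hyp01_0: "hyp01 \<nu> 0 = of_real (rGamma (\<nu> + 1))"
proof -
  have "hyp01 \<nu> (0::'a) = (\<Sum>k. of_real (bessel_coeff \<nu> k) * 0 ^ k)" by (simp add: hyp01_def)
  also have "\<dots> = of_real (bessel_coeff \<nu> 0)" by (rule powser_zero)
  finally show ?thesis by (simp add: bessel_coeff_def)
qed

lemma hyp01_of_real:
  assumes "\<nu> > -1"
  shows "hyp01 \<nu> (of_real x :: 'a) = (of_real (hyp01 \<nu> x) :: 'a::{real_normed_field,banach})"
  using hyp01_summable[OF assms, of x] unfolding hyp01_def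
  by (simp add: suminf_of_real)

lemma hyp01_pos:
  fixes x :: real
  assumes "\<nu> > -1" "x \<ge> 0"
  shows "hyp01 \<nu> x > 0"
proof -
  have "(\<Sum>k. of_real (bessel_coeff \<nu> k) * x ^ k) > 0"
  proof (rule suminf_pos2[of _ 0])
    show "0 \<le> of_real (bessel_coeff \<nu> n) * x ^ n" for n
      using bessel_coeff_pos[OF assms(1), of n] assms(2) by simp
  qed (use bessel_coeff_pos[OF assms(1), of 0] hyp01_summable[OF assms(1), of x] in auto)
  thus ?thesis by (simp add: hyp01_def)
qed

lemma has_field_derivative_hyp01:
  fixes z :: "'a::{real_normed_field,banach}"
  assumes "\<nu> > -1"
  shows "(hyp01 \<nu> has_field_derivative hyp01 (\<nu> + 1) z) (at z)"
proof -
  have "diffs (\<lambda>k. of_real (bessel_coeff \<nu> k)) n = (of_real (bessel_coeff (\<nu>+1) n) :: 'a)" for n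
  proof -
    have "real (Suc n) * bessel_coeff \<nu> (Suc n) = bessel_coeff (\<nu>+1) n"
      by (simp add: bessel_coeff_def field_simps del: of_nat_Suc) (simp add: algebra_simps)
    hence "(of_real (real (Suc n) * bessel_coeff \<nu> (Suc n)) :: 'a) = of_real (bessel_coeff (\<nu>+1) n)"
      by (rule arg_cong)
    thus ?thesis by (simp add: diffs_def del: of_nat_Suc)
  qed
  thus ?thesis
    using termdiffs_strong_converges_everywhere[OF hyp01_summable[OF assms], of z]
    unfolding hyp01_def by simp
qed

text \<open>
  In view of \<open>has_field_derivative_hyp01\<close>, this is the differential equation
  \<open>z F'' + (\<nu> + 1) F' = F\<close> for \<open>F = hyp01 \<nu>\<close>.
\<close>
lemma hyp01_contiguous:
  fixes z :: "'a::{real_normed_field,banach}"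
  assumes nu: "\<nu> > -1"
  shows "z * hyp01 (\<nu> + 2) z + of_real (\<nu> + 1) * hyp01 (\<nu> + 1) z = hyp01 \<nu> z"
proof -
  let ?c = "\<lambda>k. of_real (bessel_coeff \<nu> k) * z ^ k" and ?d = "\<lambda>k. of_real (bessel_coeff (\<nu>+1) k) * z ^ k"
    and ?e = "\<lambda>k. of_real (bessel_coeff (\<nu>+2) k) * z ^ k"
  have s: "summable ?c" "summable ?d" "summable ?e" using nu by (intro hyp01_summable; simp)+
  have r: "(\<nu> + 1 + real k) * bessel_coeff (\<nu>+1) k = bessel_coeff \<nu> k" for k
    using rGamma_plus1[of "\<nu> + 1 + real k"] by (simp add: bessel_coeff_def algebra_simps)
  have r': "real (Suc k) * bessel_coeff (\<nu>+1) (Suc k) = bessel_coeff (\<nu>+2) k" for k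
    by (simp add: bessel_coeff_def field_simps del: of_nat_Suc) (simp add: algebra_simps)
  have "hyp01 \<nu> z - of_real (\<nu> + 1) * hyp01 (\<nu> + 1) z = (\<Sum>k. ?c k - of_real (\<nu> + 1) * ?d k)"
    unfolding hyp01_def
    by (simp only: suminf_diff[OF s(1) summable_mult[OF s(2)]] suminf_mult[OF s(2), symmetric])
  also have "\<dots> = (\<Sum>k. of_real (real k * bessel_coeff (\<nu>+1) k) * z ^ k)"
  proof (rule arg_cong[where f = suminf], rule ext)
    fix k
    have "?c k - of_real (\<nu> + 1) * ?d k
        = of_real (bessel_coeff \<nu> k - (\<nu> + 1) * bessel_coeff (\<nu>+1) k) * z ^ k"
      by (simp add: left_diff_distrib)
    also have "bessel_coeff \<nu> k - (\<nu> + 1) * bessel_coeff (\<nu>+1) k = real k * bessel_coeff (\<nu>+1) k"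
      by (simp add: r[of k, symmetric] distrib_right)
    finally show "?c k - of_real (\<nu> + 1) * ?d k = of_real (real k * bessel_coeff (\<nu>+1) k) * z ^ k" .
  qed
  also have "\<dots> = (\<Sum>k. of_real (real (Suc k) * bessel_coeff (\<nu>+1) (Suc k)) * z ^ Suc k)"
  proof -
    have "summable (\<lambda>k. z * ?e k)" by (intro summable_mult s)
    hence "summable (\<lambda>k. of_real (real (Suc k) * bessel_coeff (\<nu>+1) (Suc k)) * z ^ Suc k)"
      unfolding r' by (simp add: algebra_simps)
    hence "summable (\<lambda>k. of_real (real k * bessel_coeff (\<nu>+1) k) * z ^ k)"
      by (subst (asm) summable_Suc_iff)
    from suminf_split_head[OF this] show ?thesis by simp
  qed
  also have "\<dots> = z * hyp01 (\<nu> + 2) z"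
    unfolding r' hyp01_def by (subst suminf_mult[OF s(3), symmetric]) (simp add: algebra_simps)
  finally show ?thesis by (simp add: algebra_simps)
qed

lemma bessel_I_eq_hyp01:
  assumes "\<nu> > -1"
  shows "bessel_I \<nu> x = (x / 2) powr \<nu> * hyp01 \<nu> (x\<^sup>2 / 4)"
  by (simp add: bessel_I_def hyp01_def bessel_coeff_def mult_ac)

lemma bessel_J_eq_hyp01:
  assumes "\<nu> > -1"
  shows "bessel_J \<nu> x = (x / 2) powr \<nu> * hyp01 \<nu> (- (x\<^sup>2 / 4))"
proof -
  have "(-1) ^ k * (x\<^sup>2 / 4) ^ k = (- (x\<^sup>2 / 4)) ^ k" for k
    by (subst power_minus) simp
  thus ?thesis by (simp add: bessel_J_def hyp01_def bessel_coeff_def mult_ac)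
qed

section \<open>Simplicity and reality of the zeros\<close>

lemma hyp01_holomorphic: "\<nu> > -1 \<Longrightarrow> hyp01 \<nu> holomorphic_on A"
  by (meson has_field_derivative_hyp01 field_differentiable_at_within field_differentiable_def
      holomorphic_on_def)

lemma deriv_hyp01: "\<nu> > -1 \<Longrightarrow> deriv (hyp01 \<nu>) z = hyp01 (\<nu> + 1) z" for z :: complex
  by (intro DERIV_imp_deriv has_field_derivative_hyp01)

lemma hyp01_0_nonzero: "\<nu> > -1 \<Longrightarrow> hyp01 \<nu> 0 \<noteq> 0"
  using rGamma_pos[of "\<nu> + 1"] by (simp add: hyp01_0)

text \<open>
  If two consecutive members of the family vanish at \<open>z \<noteq> 0\<close>, the contiguous relation passes this on
  to all later members. These are the derivatives of \<open>hyp01 \<nu>\<close>, which would then vanish identically.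
\<close>
lemma hyp01_simple_zero:
  fixes z :: complex
  assumes nu: "\<nu> > -1" and zero: "hyp01 \<nu> z = 0"
  shows "hyp01 (\<nu> + 1) z \<noteq> 0"
proof
  assume zero': "hyp01 (\<nu> + 1) z = 0"
  have z: "z \<noteq> 0" using zero hyp01_0_nonzero[OF nu] by auto
  have all0: "hyp01 (\<nu> + real n) z = 0 \<and> hyp01 (\<nu> + real n + 1) z = 0" for n
  proof (induction n)
    case 0
    thus ?case using zero zero' by simp
  next
    case (Suc n)
    have "hyp01 (\<nu> + real n + 2) z = 0"
      using hyp01_contiguous[of "\<nu> + real n" z] nu Suc z by simp
    thus ?case using Suc by (simp add: add_ac)
  qed
  have higher: "(deriv ^^ n) (hyp01 \<nu>) = (hyp01 (\<nu> + real n) :: complex \<Rightarrow> _)" for n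
  proof (induction n)
    case (Suc n)
    have "deriv (hyp01 (\<nu> + real n)) w = hyp01 (\<nu> + real (Suc n)) w" for w :: complex
      using deriv_hyp01[of "\<nu> + real n" w] nu by (simp add: add_ac)
    thus ?case by (simp add: Suc fun_eq_iff)
  qed simp
  have "hyp01 \<nu> 0 = (0 :: complex)"
    by (rule holomorphic_fun_eq_0_on_connected[of _ UNIV z])
       (use hyp01_holomorphic[OF nu] higher all0 in auto)
  thus False using hyp01_0_nonzero[OF nu] by blast
qed

text \<open>
  The function \<open>u(t) = hyp01 \<nu> (t a)\<close> solves \<open>(t powr (\<nu> + 1) u')' = a t powr \<nu> u\<close>, a
  Sturm--Liouville equation with eigenvalue \<open>a\<close> on \<open>[0, 1]\<close>. Its boundary terms vanish: at \<open>0\<close> because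
  \<open>\<nu> + 1 > 0\<close>, at \<open>1\<close> because \<open>a\<close> is a zero. Self-adjointness thus forces \<open>a\<close> to be
  real. In place of an integral, the proof follows \<open>W = Im a \<cdot> t powr (\<nu> + 1) \<cdot> Im (u' cnj u)\<close>, whose
  derivative \<open>(Im a)\<^sup>2 t powr \<nu> |u|\<^sup>2\<close> is nonnegative for either sign of \<open>Im a\<close>.
\<close>
lemma hyp01_zero_real:
  assumes nu: "\<nu> > -1" and zero: "hyp01 \<nu> a = 0"
  shows "Im a = 0"
proof (rule ccontr)
  assume Im: "Im a \<noteq> 0"
  define u where "u t = hyp01 \<nu> (of_real t * a)" for t :: real
  define p where "p t = hyp01 (\<nu> + 1) (of_real t * a)" for t :: real
  define q where "q t = hyp01 (\<nu> + 2) (of_real t * a)" for t :: real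
  define V where "V t = a * p t * cnj (u t)" for t
  define W where "W t = Im a * (t powr (\<nu> + 1) * Im (V t))" for t
  have du: "(u has_vector_derivative p t * a) (at t)" for t
    unfolding u_def p_def
    by (rule has_vector_derivative_real_field[of "\<lambda>z. hyp01 \<nu> (z * a)"])
       (auto intro!: derivative_eq_intros DERIV_chain2[OF has_field_derivative_hyp01[OF nu]])
  have dp: "(p has_vector_derivative q t * a) (at t)" for t
    unfolding p_def q_def
    by (rule has_vector_derivative_real_field[of "\<lambda>z. hyp01 (\<nu> + 1) (z * a)"])
       (use nu has_field_derivative_hyp01[of "\<nu> + 1"] in
        \<open>auto intro!: derivative_eq_intros DERIV_chain2[of "hyp01 (\<nu> + 1)"] simp: add.assoc\<close>)
  have ode: "of_real t * a * q t + of_real (\<nu> + 1) * p t = u t" for t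
    unfolding u_def p_def q_def by (rule hyp01_contiguous[OF nu])
  have dV: "(V has_vector_derivative a * p t * cnj (p t * a) + a * (q t * a) * cnj (u t)) (at t)" for t
    unfolding V_def
    by (intro has_vector_derivative_mult has_vector_derivative_cnj du
          has_vector_derivative_mult_right dp)
  have dImV: "((\<lambda>t. Im (V t)) has_real_derivative Im (a * (q t * a) * cnj (u t))) (at t)" for t
  proof -
    have "Im (a * p t * cnj (p t * a)) = 0" by (simp add: algebra_simps)
    thus ?thesis
      using bounded_linear.has_vector_derivative[OF bounded_linear_Im dV[of t]]
      by (simp only: has_real_derivative_iff_has_vector_derivative plus_complex.sel add_0_left)
  qed
  have dW: "(W has_real_derivative (Im a)\<^sup>2 * t powr \<nu> * (norm (u t))\<^sup>2) (at t)" if t: "t > 0" for t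
  proof -
    have "(W has_real_derivative Im a * ((\<nu> + 1) * t powr (\<nu> + 1 - 1) * Im (V t)
             + Im (a * (q t * a) * cnj (u t)) * t powr (\<nu> + 1))) (at t)"
      unfolding W_def
      by (rule DERIV_cmult[OF DERIV_mult[OF has_real_derivative_powr[OF t] dImV]])
    also have "t powr (\<nu> + 1) = t * t powr \<nu>" using t by (simp add: powr_add)
    also have "Im a * ((\<nu> + 1) * t powr (\<nu> + 1 - 1) * Im (V t)
             + Im (a * (q t * a) * cnj (u t)) * (t * t powr \<nu>)) =
          Im a * t powr \<nu> * Im (a * (of_real t * a * q t + of_real (\<nu> + 1) * p t) * cnj (u t))"
      unfolding V_def by (simp add: algebra_simps)
    also have "\<dots> = (Im a)\<^sup>2 * t powr \<nu> * (norm (u t))\<^sup>2"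
    proof -
      have "Im (a * (u t * cnj (u t))) = Im a * (norm (u t))\<^sup>2"
        unfolding complex_norm_square[symmetric]
        by (simp only: times_complex.sel Re_complex_of_real Im_complex_of_real)
      thus ?thesis unfolding ode by (simp only: mult.assoc power2_eq_square) (simp add: mult_ac)
    qed
    finally show ?thesis .
  qed
  have cont_W: "continuous_on {0..1} W"
  proof -
    have "continuous_on {0..1} (\<lambda>t. Im (V t))"
      using dImV by (intro continuous_at_imp_continuous_on ballI DERIV_isCont) auto
    thus ?thesis unfolding W_def using nu
      by (intro continuous_on_mult continuous_on_const continuous_on_powr' continuous_on_id) auto
  qed
  have W_mono: "W s \<le> W t" if st: "0 \<le> s" "s \<le> t" "t \<le> 1" for s t
  proof (rule DERIV_nonneg_imp_increasing_open[OF st(2)])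
    fix r assume "s < r"
    hence "r > 0" using st by simp
    thus "\<exists>y. (W has_real_derivative y) (at r) \<and> 0 \<le> y"
      by (intro exI conjI, rule dW) auto
  next
    show "continuous_on {s..t} W" by (rule continuous_on_subset[OF cont_W]) (use st in auto)
  qed
  have "W 0 = 0" "W 1 = 0" using zero by (simp_all add: W_def V_def u_def)
  hence W0: "W t = 0" if "t \<in> {0..1}" for t
    using W_mono[of 0 t] W_mono[of t 1] that by simp
  have u0: "u t = 0" if t: "t \<in> {0<..<1}" for t
  proof -
    have "(W has_real_derivative 0) (at t)"
      by (rule has_field_derivative_transform_within_open[of "\<lambda>_. 0" _ _ "{0<..<1}"])
         (use W0 t in auto)
    hence "(Im a)\<^sup>2 * t powr \<nu> * (norm (u t))\<^sup>2 = 0"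
      using dW[of t] t DERIV_unique by force
    thus ?thesis using Im t by simp
  qed
  have "continuous_on (closure {0<..<1}) u"
    using du by (intro continuous_at_imp_continuous_on) (auto dest: has_vector_derivative_continuous)
  hence "u 0 = 0"
    by (rule continuous_constant_on_closure) (use u0 in auto)
  thus False using hyp01_0_nonzero[OF nu, where 'a = complex] by (simp add: u_def)
qed

section \<open>Partial fractions over the zeros\<close>

definition neg_zeros :: "real \<Rightarrow> real set" where
  "neg_zeros \<nu> = {b. b > 0 \<and> hyp01 \<nu> (- b) = 0}"

lemma zeros_upto_hyp01:
  assumes nu: "\<nu> > -1"
  shows "zeros_upto (hyp01 \<nu>) R = (\<lambda>b. - of_real b) ` {b \<in> neg_zeros \<nu>. b \<le> R}"
proof (intro equalityI subsetI)
  fix a assume "a \<in> zeros_upto (hyp01 \<nu>) R"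
  hence a: "hyp01 \<nu> a = 0" "norm a \<le> R" by (auto simp: zeros_upto_def)
  have eq: "a = of_real (Re a)" using hyp01_zero_real[OF nu a(1)] by (simp add: complex_eq_iff)
  have "of_real (hyp01 \<nu> (Re a)) = (0 :: complex)"
    using a(1) by (subst (asm) eq) (simp add: hyp01_of_real[OF nu])
  hence re: "hyp01 \<nu> (Re a) = 0" by simp
  hence neg: "Re a < 0" using hyp01_pos[OF nu, of "Re a"] by force
  have "norm a = - Re a" using neg by (subst eq) simp
  thus "a \<in> (\<lambda>b. - of_real b) ` {b \<in> neg_zeros \<nu>. b \<le> R}"
    using re neg eq a(2) by (intro image_eqI[of _ _ "- Re a"]) (auto simp: neg_zeros_def)
next
  fix a assume "a \<in> (\<lambda>b. - of_real b :: complex) ` {b \<in> neg_zeros \<nu>. b \<le> R}"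
  then obtain b where b: "a = of_real (- b)" "b > 0" "hyp01 \<nu> (- b) = 0" "b \<le> R"
    by (auto simp: neg_zeros_def)
  have "hyp01 \<nu> a = 0" unfolding b(1) hyp01_of_real[OF nu] b(3) by simp
  thus "a \<in> zeros_upto (hyp01 \<nu>) R" using b by (simp add: zeros_upto_def)
qed

lemma finite_neg_zeros:
  assumes nu: "\<nu> > -1"
  shows "finite {b \<in> neg_zeros \<nu>. b \<le> R}"
proof -
  have "finite ((\<lambda>b. - of_real b :: complex) ` {b \<in> neg_zeros \<nu>. b \<le> R})"
    unfolding zeros_upto_hyp01[OF nu, symmetric]
    by (intro finite_zeros_upto hyp01_holomorphic hyp01_0_nonzero nu)
  thus ?thesis by (rule finite_imageD) (auto simp: inj_on_def)
qed

lemma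
  assumes nu: "\<nu> > -1" and w: "w > 0"
  shows hyp01_partial_fractions:
      "((\<lambda>R. \<Sum>b | b \<in> neg_zeros \<nu> \<and> b \<le> R. 1 / (w + b)) \<longlongrightarrow> hyp01 (\<nu> + 1) w / hyp01 \<nu> w) at_top" (is ?T1)
    and hyp01_partial_fractions_squared:
      "((\<lambda>R. \<Sum>b | b \<in> neg_zeros \<nu> \<and> b \<le> R. 1 / (w + b)\<^sup>2) \<longlongrightarrow>
         (hyp01 (\<nu> + 1) w / hyp01 \<nu> w)\<^sup>2 - hyp01 (\<nu> + 2) w / hyp01 \<nu> w) at_top" (is ?T2)
proof -
  let ?f = "hyp01 \<nu> :: complex \<Rightarrow> complex" and ?w = "of_real w :: complex"
  have pos: "hyp01 \<nu> w > 0" using hyp01_pos[OF nu] w by simp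
  have fw: "?f ?w \<noteq> 0" using pos by (simp add: hyp01_of_real[OF nu])
  have simple: "deriv ?f z \<noteq> 0" if "?f z = 0" for z
    using hyp01_simple_zero[OF nu that] by (simp add: deriv_hyp01[OF nu])
  have type: "\<exists>C>0. \<forall>z. norm (?f z) \<le> C * exp (\<epsilon> * norm z)" if "\<epsilon> > 0" for \<epsilon>
    using norm_hyp01_le[OF nu that] by metis
  note lims = log_deriv_partial_fractions[OF hyp01_holomorphic[OF nu] hyp01_0_nonzero[OF nu] simple type fw]
    deriv_log_deriv_partial_fractions[OF hyp01_holomorphic[OF nu] hyp01_0_nonzero[OF nu] simple type fw]
  have inj: "inj_on (\<lambda>b. - of_real b :: complex) A" for A by (auto simp: inj_on_def)
  have "(\<lambda>R. \<Sum>a\<in>zeros_upto ?f R. 1 / (?w - a)) =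
        (\<lambda>R. of_real (\<Sum>b | b \<in> neg_zeros \<nu> \<and> b \<le> R. 1 / (w + b)))"
    by (simp add: zeros_upto_hyp01[OF nu] sum.reindex[OF inj])
  moreover have "deriv ?f ?w / ?f ?w = of_real (hyp01 (\<nu> + 1) w / hyp01 \<nu> w)"
    using nu by (simp add: deriv_hyp01 hyp01_of_real)
  ultimately show ?T1 using lims(1) by (simp only: tendsto_of_real_iff)
  have "(\<lambda>R. \<Sum>a\<in>zeros_upto ?f R. - 1 / (?w - a)\<^sup>2) =
        (\<lambda>R. of_real (- (\<Sum>b | b \<in> neg_zeros \<nu> \<and> b \<le> R. 1 / (w + b)\<^sup>2)))"
    by (simp add: zeros_upto_hyp01[OF nu] sum.reindex[OF inj] sum_negf)
  moreover have "deriv (\<lambda>z. deriv ?f z / ?f z) ?w =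
      of_real (hyp01 (\<nu> + 2) w / hyp01 \<nu> w - (hyp01 (\<nu> + 1) w / hyp01 \<nu> w)\<^sup>2)"
  proof -
    have "((\<lambda>z. hyp01 (\<nu> + 1) z / ?f z) has_field_derivative
             (hyp01 (\<nu> + 2) ?w * ?f ?w - hyp01 (\<nu> + 1) ?w * hyp01 (\<nu> + 1) ?w) / (?f ?w * ?f ?w)) (at ?w)"
      using has_field_derivative_hyp01[of "\<nu> + 1" ?w] nu
      by (intro DERIV_divide has_field_derivative_hyp01 fw) (auto simp: add.assoc)
    hence "deriv (\<lambda>z. deriv ?f z / ?f z) ?w =
             (hyp01 (\<nu> + 2) ?w * ?f ?w - hyp01 (\<nu> + 1) ?w * hyp01 (\<nu> + 1) ?w) / (?f ?w * ?f ?w)"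
      by (simp add: deriv_hyp01[OF nu] DERIV_imp_deriv)
    also have "\<dots> = of_real (hyp01 (\<nu> + 2) w / hyp01 \<nu> w - (hyp01 (\<nu> + 1) w / hyp01 \<nu> w)\<^sup>2)"
      using nu pos by (simp add: hyp01_of_real field_simps power2_eq_square)
    finally show ?thesis .
  qed
  ultimately have "((\<lambda>R. - (\<Sum>b | b \<in> neg_zeros \<nu> \<and> b \<le> R. 1 / (w + b)\<^sup>2)) \<longlongrightarrow>
      hyp01 (\<nu> + 2) w / hyp01 \<nu> w - (hyp01 (\<nu> + 1) w / hyp01 \<nu> w)\<^sup>2) at_top"
    using lims(2) by (simp only: tendsto_of_real_iff)
  from tendsto_minus[OF this] show ?T2 by simp
qed

text \<open>
  If there were finitely many zeros, then \<open>L = F' / F\<close> and \<open>L'\<close> would be \<open>O(1 / w)\<close> and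
  \<open>O(1 / w\<^sup>2)\<close>, so the left-hand side of the Riccati equation would tend to \<open>0\<close>, not \<open>1\<close>.
\<close>
lemma infinite_neg_zeros:
  assumes nu: "\<nu> > -1"
  shows "infinite (neg_zeros \<nu>)"
proof
  let ?B = "neg_zeros \<nu>"
  assume fin: "finite ?B"
  define S where "S w = (\<Sum>b\<in>?B. 1 / (w + b))" for w
  define T where "T w = (\<Sum>b\<in>?B. 1 / (w + b)\<^sup>2)" for w
  have riccati: "w * (S w)\<^sup>2 - w * T w + (\<nu> + 1) * S w = 1" if w: "w > 0" for w
  proof -
    have "\<forall>\<^sub>F R in at_top. {b. b \<in> ?B \<and> b \<le> R} = ?B"
      using eventually_ge_at_top[of "Max ?B"]
      by eventually_elim (use fin in \<open>auto dest: Max_ge\<close>)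
    hence ev: "\<forall>\<^sub>F R in at_top. (\<Sum>b | b \<in> ?B \<and> b \<le> R. g b) = (\<Sum>b\<in>?B. g b)" for g :: "real \<Rightarrow> real"
      by eventually_elim simp
    have S: "S w = hyp01 (\<nu> + 1) w / hyp01 \<nu> w"
      using hyp01_partial_fractions[OF nu w] unfolding tendsto_cong[OF ev]
      by (simp add: S_def tendsto_const_iff)
    have T: "T w = (S w)\<^sup>2 - hyp01 (\<nu> + 2) w / hyp01 \<nu> w"
      using hyp01_partial_fractions_squared[OF nu w] unfolding tendsto_cong[OF ev]
      by (simp add: T_def S tendsto_const_iff)
    have "hyp01 \<nu> w > 0" using hyp01_pos[OF nu] w by simp
    thus ?thesis unfolding T using hyp01_contiguous[OF nu, of w]
      by (simp add: S field_simps)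
  qed
  have b0: "b > 0" if "b \<in> ?B" for b using that by (simp add: neg_zeros_def)
  have S0: "(S \<longlongrightarrow> 0) at_top"
  proof -
    have "(S \<longlongrightarrow> (\<Sum>b\<in>?B. 0)) at_top" unfolding S_def by (intro tendsto_sum) real_asymp
    thus ?thesis by simp
  qed
  have wS: "((\<lambda>w. w * S w) \<longlongrightarrow> (\<Sum>b\<in>?B. 1)) at_top"
    unfolding S_def sum_distrib_left by (intro tendsto_sum) real_asymp
  have wT: "((\<lambda>w. w * T w) \<longlongrightarrow> 0) at_top"
  proof -
    have "((\<lambda>w. w * T w) \<longlongrightarrow> (\<Sum>b\<in>?B. 0)) at_top"
      unfolding T_def sum_distrib_left by (intro tendsto_sum) real_asymp
    thus ?thesis by simp
  qed
  have "((\<lambda>w. (w * S w) * S w - w * T w + (\<nu> + 1) * S w) \<longlongrightarrow> (\<Sum>b\<in>?B. 1) * 0 - 0 + (\<nu> + 1) * 0) at_top"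
    by (intro tendsto_intros S0 wS wT)
  moreover have "\<forall>\<^sub>F w in at_top. (w * S w) * S w - w * T w + (\<nu> + 1) * S w = 1"
    using eventually_gt_at_top[of 0]
  proof eventually_elim
    case (elim w)
    show ?case using riccati[OF elim] by (simp add: power2_eq_square mult.assoc)
  qed
  ultimately have "((\<lambda>w::real. 1) \<longlongrightarrow> (\<Sum>b\<in>?B. 1) * 0 - 0 + (\<nu> + 1) * 0) at_top"
    by (rule Lim_transform_eventually)
  thus False by (simp add: tendsto_const_iff)
qed

section \<open>Enumeration of the zeros\<close>

text \<open>
  The recursion is only assumed at \<open>n\<close> with \<open>z n \<ge> 0\<close>, which holds for all \<open>n\<close> a
  posteriori. This admits recursions whose defining predicate describes \<open>P\<close> correctly
  on the positive half-line only, as is the case for \<open>bessel_J\<close>.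
\<close>
lemma enumeration_by_Least:
  fixes P :: "real set" and z :: "nat \<Rightarrow> real"
  assumes pos: "\<And>x. x \<in> P \<Longrightarrow> x > 0" and inf: "infinite P"
    and fin: "\<And>R. finite {x \<in> P. x \<le> R}"
    and z0: "z 0 = 0" and zS: "\<And>n. z n \<ge> 0 \<Longrightarrow> z (Suc n) = (LEAST x. x > z n \<and> x \<in> P)"
  shows "strict_mono z" "\<And>n. z (Suc n) \<in> P"
    "\<And>n. {x \<in> P. x \<le> z n} = (\<lambda>k. z (Suc k)) ` {..<n}" "filterlim z at_top sequentially"
proof -
  have step0: "z (Suc n) \<in> P \<and> z n < z (Suc n) \<and> (\<forall>x\<in>P. x > z n \<longrightarrow> z (Suc n) \<le> x)"
    if nonneg: "z n \<ge> 0" for n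
  proof -
    have "infinite (P - {x \<in> P. x \<le> z n})" using inf fin by (intro Diff_infinite_finite) auto
    then obtain x0 where x0: "x0 \<in> P" "x0 > z n"
      by (metis (no_types, lifting) Diff_iff finite.emptyI ex_in_conv mem_Collect_eq not_le)
    define F where "F = {x \<in> P. x > z n \<and> x \<le> x0}"
    have F: "finite F" "F \<noteq> {}"
      using x0 by (auto simp: F_def intro: finite_subset[OF _ fin[of x0]])
    have "z (Suc n) = Min F"
      unfolding zS[OF nonneg]
    proof (rule Least_equality)
      show "z n < Min F \<and> Min F \<in> P" using Min_in[OF F] by (simp add: F_def)
      fix y assume y: "z n < y \<and> y \<in> P"
      show "Min F \<le> y"
      proof (cases "y \<le> x0")
        case True
        thus ?thesis using y F by (intro Min_le) (auto simp: F_def)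
      next
        case False
        have "Min F \<le> x0" using x0 F by (intro Min_le) (auto simp: F_def)
        thus ?thesis using False by simp
      qed
    qed
    moreover have "Min F \<le> y" if "y \<in> P" "y > z n" for y
    proof (cases "y \<le> x0")
      case True
      thus ?thesis using that F by (intro Min_le) (auto simp: F_def)
    next
      case False
      have "Min F \<le> x0" using x0 F by (intro Min_le) (auto simp: F_def)
      thus ?thesis using False by simp
    qed
    ultimately show ?thesis using Min_in[OF F] by (simp add: F_def)
  qed
  have "z n \<ge> 0" for n
    by (induction n) (use z0 step0 pos in \<open>auto intro: less_imp_le\<close>)
  note step = step0[OF this]
  show mono: "strict_mono z" unfolding strict_mono_Suc_iff using step by blast
  show inP: "z (Suc n) \<in> P" for n using step by blast
  show "{x \<in> P. x \<le> z n} = (\<lambda>k. z (Suc k)) ` {..<n}" for n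
  proof (induction n)
    case 0
    thus ?case using pos z0 by force
  next
    case (Suc n)
    have "{x \<in> P. x \<le> z (Suc n)} = insert (z (Suc n)) {x \<in> P. x \<le> z n}"
      using step[of n] by force
    thus ?case using Suc by (auto simp: lessThan_Suc)
  qed
  show "filterlim z at_top sequentially"
    unfolding filterlim_at_top eventually_sequentially
  proof (rule allI, rule ccontr)
    fix R assume neg: "\<not> (\<exists>N. \<forall>n\<ge>N. R \<le> z n)"
    have "z n \<le> R" for n
    proof -
      obtain m where "m \<ge> n" "z m < R" using neg by (meson not_le)
      thus ?thesis using strict_mono_less_eq[OF mono, of n m] by simp
    qed
    hence "range (\<lambda>n. z (Suc n)) \<subseteq> {x \<in> P. x \<le> R}" using inP by auto
    hence "finite (range (\<lambda>n. z (Suc n)))" using fin finite_subset by blast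
    moreover have "inj (\<lambda>n. z (Suc n))"
      using strict_mono_eq[OF mono] by (auto simp: inj_on_def)
    ultimately show False using finite_imageD infinite_UNIV_nat by blast
  qed
qed

text \<open>
  The first \<open>n\<close> zeros of \<open>bessel_J \<nu>\<close> correspond under \<open>b = j\<^sup>2 / 4\<close> to the members of
  \<open>neg_zeros \<nu>\<close> up to \<open>R = j\<^sub>n\<^sup>2 / 4\<close>, so the partial sums of the series form a subsequence of the
  truncations by modulus.
\<close>
lemma sums_neg_zeros:
  fixes g :: "real \<Rightarrow> real"
  assumes nu: "\<nu> > -1"
    and lim: "((\<lambda>R. \<Sum>b | b \<in> neg_zeros \<nu> \<and> b \<le> R. g b) \<longlongrightarrow> l) at_top"
  shows "(\<lambda>k. g ((bessel_J_zero \<nu> (Suc k))\<^sup>2 / 4)) sums l"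
proof -
  define P where "P = {x. x > 0 \<and> bessel_J \<nu> x = 0}"
  let ?z = "bessel_J_zero \<nu>" and ?s = "\<lambda>x::real. x\<^sup>2 / 4"
  have P_iff: "x \<in> P \<longleftrightarrow> x > 0 \<and> ?s x \<in> neg_zeros \<nu>" for x
    by (auto simp: P_def neg_zeros_def bessel_J_eq_hyp01[OF nu])
  have inj: "inj_on ?s A" if "A \<subseteq> {0<..}" for A
    using that by (intro inj_onI) (auto simp: power2_eq_iff_nonneg subset_iff less_imp_le)
  have surj: "b \<in> ?s ` {x \<in> P. x \<le> R}" if b: "b \<in> neg_zeros \<nu>" "b \<le> ?s R" and R: "R \<ge> 0" for b R
  proof (rule image_eqI[of _ _ "2 * sqrt b"])
    have "b > 0" using b by (simp add: neg_zeros_def)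
    thus eq: "b = ?s (2 * sqrt b)" by (simp add: power_mult_distrib)
    have "(2 * sqrt b)\<^sup>2 \<le> R\<^sup>2" using eq b by simp
    hence "2 * sqrt b \<le> R" using R by (rule power2_le_imp_le)
    thus "2 * sqrt b \<in> {x \<in> P. x \<le> R}" using \<open>b > 0\<close> b(1) eq by (simp add: P_iff)
  qed
  have image: "{b \<in> neg_zeros \<nu>. b \<le> ?s R} = ?s ` {x \<in> P. x \<le> R}" if R: "R \<ge> 0" for R
    using surj R by (auto simp: P_iff intro!: power_mono)
  have finP: "finite {x \<in> P. x \<le> R}" for R
  proof -
    have "finite (?s ` {x \<in> P. x \<le> max R 0})"
      unfolding image[of "max R 0", OF max.cobounded2, symmetric] by (rule finite_neg_zeros[OF nu])
    hence "finite {x \<in> P. x \<le> max R 0}"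
      by (rule finite_imageD) (intro inj, auto simp: P_def)
    thus ?thesis by (rule finite_subset[rotated]) auto
  qed
  have infP: "infinite P"
  proof
    assume "finite P"
    moreover have "neg_zeros \<nu> \<subseteq> ?s ` P"
    proof
      fix b assume b: "b \<in> neg_zeros \<nu>"
      hence "b > 0" by (simp add: neg_zeros_def)
      hence "b \<le> ?s (2 * sqrt b)" by (simp add: power_mult_distrib)
      from surj[OF b this] \<open>b > 0\<close> show "b \<in> ?s ` P" by auto
    qed
    ultimately show False using infinite_neg_zeros[OF nu] finite_subset by blast
  qed
  have zS: "?z (Suc n) = (LEAST x. x > ?z n \<and> x \<in> P)" if "?z n \<ge> 0" for n
  proof -
    have "(\<lambda>x. x > ?z n \<and> bessel_J \<nu> x = 0) = (\<lambda>x. x > ?z n \<and> x \<in> P)"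
      using that by (auto simp: P_def fun_eq_iff)
    thus ?thesis by simp
  qed
  note enum = enumeration_by_Least[of P ?z, OF _ infP finP _ zS]
  have pos: "x > 0" if "x \<in> P" for x using that by (simp add: P_def)
  have mono: "strict_mono ?z" and inP: "\<And>n. ?z (Suc n) \<in> P"
    and upto: "\<And>n. {x \<in> P. x \<le> ?z n} = (\<lambda>k. ?z (Suc k)) ` {..<n}"
    and top: "filterlim ?z at_top sequentially"
    using enum pos by simp_all
  have nonneg: "?z n \<ge> 0" for n
    using strict_mono_less_eq[OF mono, of 0 n] by simp
  have partial: "(\<Sum>k<n. g (?s (?z (Suc k)))) = (\<Sum>b | b \<in> neg_zeros \<nu> \<and> b \<le> ?s (?z n). g b)" for n
  proof -
    have "inj_on (\<lambda>k. ?z (Suc k)) {..<n}"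
      using strict_mono_eq[OF mono] by (auto simp: inj_on_def simp del: bessel_J_zero.simps)
    moreover have "inj_on ?s ((\<lambda>k. ?z (Suc k)) ` {..<n})"
      by (intro inj) (use inP pos in auto)
    ultimately show ?thesis
      unfolding image[OF nonneg] upto by (subst sum.reindex, simp, subst sum.reindex) simp_all
  qed
  have "filterlim (\<lambda>x::real. x\<^sup>2 / 4) at_top at_top" by real_asymp
  hence "filterlim (\<lambda>n. ?s (?z n)) at_top sequentially" by (rule filterlim_compose[OF _ top])
  from filterlim_compose[OF lim this] show ?thesis
    unfolding sums_def partial by simp
qed

section \<open>The critical point of the modified Bessel function\<close>

lemma has_real_derivative_bessel_I:
  assumes nu: "\<nu> > -1" and x: "x > 0"
  shows "(bessel_I \<nu> has_real_derivative
           (x / 2) powr \<nu> / x * (\<nu> * hyp01 \<nu> (x\<^sup>2 / 4) + 2 * (x\<^sup>2 / 4) * hyp01 (\<nu> + 1) (x\<^sup>2 / 4))) (at x)"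
proof -
  have "((\<lambda>x. x / 2) has_real_derivative 1 / 2) (at x)" by (auto intro!: derivative_eq_intros)
  hence "((\<lambda>x. (x / 2) powr \<nu>) has_real_derivative \<nu> * (x / 2) powr (\<nu> - 1) * (1 / 2)) (at x)"
    by (rule DERIV_chain2[where f = "\<lambda>z. z powr \<nu>" and g = "\<lambda>x. x / 2",
                OF has_real_derivative_powr, rotated]) (use x in simp)
  moreover have "((\<lambda>x. x\<^sup>2 / 4) has_real_derivative x / 2) (at x)"
    by (auto intro!: derivative_eq_intros)
  hence "((\<lambda>x. hyp01 \<nu> (x\<^sup>2 / 4)) has_real_derivative hyp01 (\<nu> + 1) (x\<^sup>2 / 4) * (x / 2)) (at x)"
    by (rule DERIV_chain2[OF has_field_derivative_hyp01[OF nu]])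
  ultimately have "((\<lambda>x. (x / 2) powr \<nu> * hyp01 \<nu> (x\<^sup>2 / 4)) has_real_derivative
      \<nu> * (x / 2) powr (\<nu> - 1) * (1 / 2) * hyp01 \<nu> (x\<^sup>2 / 4) +
      hyp01 (\<nu> + 1) (x\<^sup>2 / 4) * (x / 2) * (x / 2) powr \<nu>) (at x)"
    by (rule DERIV_mult)
  also have "(\<lambda>x. (x / 2) powr \<nu> * hyp01 \<nu> (x\<^sup>2 / 4)) = bessel_I \<nu>"
    by (simp add: bessel_I_eq_hyp01[OF nu] fun_eq_iff)
  also have "(x / 2) powr (\<nu> - 1) = (x / 2) powr \<nu> / (x / 2)"
    using x by (simp add: powr_diff)
  finally show ?thesis
    by (rule back_subst[of "\<lambda>d. (bessel_I \<nu> has_real_derivative d) (at x)"])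
       (use x in \<open>simp add: field_simps power2_eq_square\<close>)
qed

text \<open>
  The left-hand side is strictly increasing, since its derivative
  \<open>(\<nu> + 2) hyp01 (\<nu> + 1) w + 2 w hyp01 (\<nu> + 2) w\<close> is positive, and it equals \<open>\<nu> / \<Gamma>(\<nu> + 1) < 0\<close> at \<open>0\<close>. At
  \<open>1\<close> it is already positive, by two applications of the contiguous relation.
\<close>
lemma ex1_critical_point:
  assumes nu: "-1 < \<nu>" "\<nu> < 0"
  shows "\<exists>!w::real. w > 0 \<and> \<nu> * hyp01 \<nu> w + 2 * w * hyp01 (\<nu> + 1) w = 0"
proof -
  define q where "q w = \<nu> * hyp01 \<nu> w + 2 * w * hyp01 (\<nu> + 1) w" for w :: real
  have dq: "(q has_real_derivative (\<nu> + 2) * hyp01 (\<nu> + 1) w + 2 * w * hyp01 (\<nu> + 2) w) (at w)" for w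
  proof -
    have "(hyp01 (\<nu> + 1) has_real_derivative hyp01 (\<nu> + 2) w) (at w)"
      using has_field_derivative_hyp01[of "\<nu> + 1" w] nu by (simp add: add.assoc)
    thus ?thesis unfolding q_def
      by (auto intro!: derivative_eq_intros has_field_derivative_hyp01 nu simp: algebra_simps)
  qed
  have incr: "q v < q w" if "0 \<le> v" "v < w" for v w
  proof (rule DERIV_pos_imp_increasing[OF that(2)])
    fix t assume "v \<le> t"
    hence "(\<nu> + 2) * hyp01 (\<nu> + 1) t + 2 * t * hyp01 (\<nu> + 2) t > 0"
      using nu that hyp01_pos[of "\<nu> + 1" t] hyp01_pos[of "\<nu> + 2" t] by (intro add_pos_nonneg) auto
    thus "\<exists>y. (q has_real_derivative y) (at t) \<and> y > 0" using dq by blast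
  qed
  have "q 0 < 0"
    using nu rGamma_pos[of "\<nu> + 1"] by (simp add: q_def hyp01_0 mult_neg_pos)
  moreover have "q 1 > 0"
  proof -
    have p: "hyp01 (\<nu> + 2) (1::real) > 0" "hyp01 (\<nu> + 3) (1::real) > 0" using nu by (auto intro!: hyp01_pos)
    have c1: "hyp01 \<nu> 1 = hyp01 (\<nu> + 2) 1 + (\<nu> + 1) * hyp01 (\<nu> + 1) (1::real)"
      using hyp01_contiguous[of \<nu> "1::real"] nu by simp
    have "hyp01 (\<nu> + 1) 1 = hyp01 (\<nu> + 3) 1 + (\<nu> + 2) * hyp01 (\<nu> + 2) (1::real)"
      using hyp01_contiguous[of "\<nu> + 1" "1::real"] nu by (simp add: add.assoc)
    hence c2: "hyp01 (\<nu> + 1) (1::real) > (\<nu> + 2) * hyp01 (\<nu> + 2) 1" using p by simp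
    have "\<nu> * (\<nu> + 1) \<ge> - 1" using nu mult_mono[of "- \<nu>" 1 "\<nu> + 1" 1] by simp
    hence "(\<nu> * (\<nu> + 1) + 2) * hyp01 (\<nu> + 1) 1 \<ge> 1 * hyp01 (\<nu> + 1) (1::real)"
      using hyp01_pos[of "\<nu> + 1" "1::real"] nu by (intro mult_right_mono) auto
    hence "q 1 > \<nu> * hyp01 (\<nu> + 2) 1 + (\<nu> + 2) * hyp01 (\<nu> + 2) 1"
      using c2 by (simp add: q_def c1 algebra_simps)
    also have "\<nu> * hyp01 (\<nu> + 2) 1 + (\<nu> + 2) * hyp01 (\<nu> + 2) (1::real) = 2 * (\<nu> + 1) * hyp01 (\<nu> + 2) 1"
      by (simp add: algebra_simps)
    finally show ?thesis using p(1) nu by (smt (verit) mult_pos_pos)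
  qed
  moreover have "continuous_on {0..1} q"
    using dq by (intro continuous_at_imp_continuous_on ballI DERIV_isCont)
  ultimately obtain w where w: "0 \<le> w" "w \<le> 1" "q w = 0"
    using IVT'[of q 0 0 1] by auto
  have "w \<noteq> 0" using w \<open>q 0 < 0\<close> by auto
  show ?thesis
  proof (rule ex1I)
    show "w > 0 \<and> \<nu> * hyp01 \<nu> w + 2 * w * hyp01 (\<nu> + 1) w = 0"
      using w \<open>w \<noteq> 0\<close> by (simp add: q_def)
    fix v assume "v > 0 \<and> \<nu> * hyp01 \<nu> v + 2 * v * hyp01 (\<nu> + 1) v = 0"
    hence "v > 0" "q v = 0" by (auto simp: q_def)
    thus "v = w" using incr[of v w] incr[of w v] w by force
  qed
qed

lemma bessel_I_deriv_zero_correct: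
  assumes nu: "-1 < \<nu>" "\<nu> < 0"
  defines "x \<equiv> bessel_I_deriv_zero \<nu>"
  shows "x > 0" "\<nu> * hyp01 \<nu> (x\<^sup>2 / 4) + 2 * (x\<^sup>2 / 4) * hyp01 (\<nu> + 1) (x\<^sup>2 / 4) = 0"
proof -
  let ?q = "\<lambda>w::real. \<nu> * hyp01 \<nu> w + 2 * w * hyp01 (\<nu> + 1) w"
  have iff: "deriv (bessel_I \<nu>) y = 0 \<longleftrightarrow> ?q (y\<^sup>2 / 4) = 0" if "y > 0" for y
    using DERIV_imp_deriv[OF has_real_derivative_bessel_I[OF nu(1) that]] that by simp
  obtain w where w: "w > 0" "?q w = 0" and unique: "\<And>v. v > 0 \<Longrightarrow> ?q v = 0 \<Longrightarrow> v = w"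
    using ex1_critical_point[OF nu] by blast
  have "\<exists>!y. y > 0 \<and> deriv (bessel_I \<nu>) y = 0"
  proof (rule ex1I[of _ "2 * sqrt w"])
    show "2 * sqrt w > 0 \<and> deriv (bessel_I \<nu>) (2 * sqrt w) = 0"
      using w by (subst conj_cong[OF refl iff]) (auto simp: power_mult_distrib)
    fix y assume y: "y > 0 \<and> deriv (bessel_I \<nu>) y = 0"
    hence "y\<^sup>2 / 4 = w" using iff[of y] unique[of "y\<^sup>2 / 4"] by simp
    hence "w = (y / 2)\<^sup>2" by (simp add: power_divide)
    thus "y = 2 * sqrt w" using y by simp
  qed
  from theI'[OF this] have "x > 0 \<and> deriv (bessel_I \<nu>) x = 0"
    unfolding x_def bessel_I_deriv_zero_def .
  thus "x > 0" "?q (x\<^sup>2 / 4) = 0" using iff[of x] by auto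
qed

section \<open>Evaluation of the sum\<close>

theorem mainTheorem7:
  fixes \<nu> :: real
  assumes "-1 < \<nu>" and "\<nu> < 0"
  shows "(\<lambda>k. (bessel_J_zero \<nu> (Suc k))\<^sup>2 /
              ((bessel_I_deriv_zero \<nu>)\<^sup>2 + (bessel_J_zero \<nu> (Suc k))\<^sup>2)\<^sup>2)
           sums (1 / 4 + \<nu>\<^sup>2 / (4 * (bessel_I_deriv_zero \<nu>)\<^sup>2))"
proof -
  define x where "x = bessel_I_deriv_zero \<nu>"
  define w where "w = x\<^sup>2 / 4"
  have x: "x > 0" and crit: "\<nu> * hyp01 \<nu> w + 2 * w * hyp01 (\<nu> + 1) w = 0"
    using bessel_I_deriv_zero_correct[OF assms] by (simp_all add: x_def w_def)
  have w: "w > 0" using x by (simp add: w_def)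
  have pos: "hyp01 \<nu> w > 0" using hyp01_pos[of \<nu> w] assms w by simp
  define L M where "L = hyp01 (\<nu> + 1) w / hyp01 \<nu> w" and "M = hyp01 (\<nu> + 2) w / hyp01 \<nu> w"
  have L: "L = - \<nu> / (2 * w)" using crit w pos by (simp add: L_def field_simps)
  have ode: "w * M + (\<nu> + 1) * L = 1"
    using hyp01_contiguous[OF assms(1), of w] pos by (simp add: L_def M_def field_simps)
  \<comment> \<open>Since \<open>b / (w + b)\<^sup>2 = 1 / (w + b) - w / (w + b)\<^sup>2\<close>, both expansions combine to the sum that is
     wanted; \<open>M - L\<^sup>2\<close> is the derivative of the logarithmic derivative at \<open>w\<close>.\<close>
  have "((\<lambda>R. 1 / 4 * ((\<Sum>b | b \<in> neg_zeros \<nu> \<and> b \<le> R. 1 / (w + b)) -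
               w * (\<Sum>b | b \<in> neg_zeros \<nu> \<and> b \<le> R. 1 / (w + b)\<^sup>2))) \<longlongrightarrow>
           1 / 4 * (L - w * (L\<^sup>2 - M))) at_top"
    unfolding L_def M_def
    by (intro tendsto_intros hyp01_partial_fractions hyp01_partial_fractions_squared assms w)
  also have "1 / 4 * (L - w * (L\<^sup>2 - M)) = 1 / 4 * ((w * M + (\<nu> + 1) * L) - \<nu> * L - w * L\<^sup>2)"
    by (simp add: algebra_simps)
  also have "\<dots> = 1 / 4 + \<nu>\<^sup>2 / (4 * x\<^sup>2)"
    unfolding ode using w unfolding L by (simp add: w_def field_simps power2_eq_square)
  also have "(\<lambda>R. 1 / 4 * ((\<Sum>b | b \<in> neg_zeros \<nu> \<and> b \<le> R. 1 / (w + b)) -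
               w * (\<Sum>b | b \<in> neg_zeros \<nu> \<and> b \<le> R. 1 / (w + b)\<^sup>2))) =
             (\<lambda>R. \<Sum>b | b \<in> neg_zeros \<nu> \<and> b \<le> R. 1 / 4 * (b / (w + b)\<^sup>2))"
  proof (rule ext)
    fix R
    have "1 / (w + b) - w * (1 / (w + b)\<^sup>2) = b / (w + b)\<^sup>2" if "b \<in> neg_zeros \<nu>" for b
    proof -
      have "w + b > 0" using w that by (simp add: neg_zeros_def)
      hence "1 / (w + b) = (w + b) / (w + b)\<^sup>2" by (simp add: power2_eq_square)
      thus ?thesis by (simp add: diff_divide_distrib[symmetric])
    qed
    thus "1 / 4 * ((\<Sum>b | b \<in> neg_zeros \<nu> \<and> b \<le> R. 1 / (w + b)) -
               w * (\<Sum>b | b \<in> neg_zeros \<nu> \<and> b \<le> R. 1 / (w + b)\<^sup>2)) =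
          (\<Sum>b | b \<in> neg_zeros \<nu> \<and> b \<le> R. 1 / 4 * (b / (w + b)\<^sup>2))"
      unfolding sum_distrib_left sum_subtractf[symmetric] by (intro sum.cong) auto
  qed
  finally have "(\<lambda>k. 1 / 4 * ((bessel_J_zero \<nu> (Suc k))\<^sup>2 / 4 /
                   (w + (bessel_J_zero \<nu> (Suc k))\<^sup>2 / 4)\<^sup>2)) sums (1 / 4 + \<nu>\<^sup>2 / (4 * x\<^sup>2))"
    by (rule sums_neg_zeros[OF assms(1)])
  moreover have "1 / 4 * (j\<^sup>2 / 4 / (w + j\<^sup>2 / 4)\<^sup>2) = j\<^sup>2 / (x\<^sup>2 + j\<^sup>2)\<^sup>2" for j
  proof -
    have "w + j\<^sup>2 / 4 = (x\<^sup>2 + j\<^sup>2) / 4" by (simp add: w_def)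
    thus ?thesis by (simp only:) (simp add: power_divide)
  qed
  ultimately show ?thesis unfolding x_def by (simp only:)
qed

end
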